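(* For every integral curve $\gamma$ in three-dimensional Euclidean space $\mathbb{E}$, there is a finite set of unit rhombi $\rho_1,\dots,\rho_k$ such that $\gamma$ is orientably cobordant to $\rho_1\cup\dots\cup\rho_k$. Moreover, for $|\gamma|=n$, it suffices to take $k=n^2+2n-12$ rhombi.
   Context: Let $\mathbb{E}$ denote three-dimensional Euclidean space. An integral curve is a closed piecewise linear curve in $\mathbb{E}$ all of whose intervals (edges) have unit length. Its length $|\gamma|$ is the sum of all its edge lengths. $\mathcal{M}_n$ is the set of all integral curves of length $n$; elements of $\mathcal{M}_4$ are called unit rhombi (so a unit rhombus is any closed 4-gon with unit edges, not necessarily planar). Domes. Let $\gamma_1,\dots,\gamma_r$ be integral curves. A dome over $\gamma_1\cup\dots\cup\gamma_r$ is a piecewise linear complex in $\mathbb{E}$ whose facets are all unit equilateral triangles and whose boundary is $\gamma_1\cup\dots\cup\gamma_r$. It need not be embedded or immersed. When some of the boundary curves share common edges, the dome need not be purely 2-dimensional (it may contain edges lying in no triangle). The closure of an integral curve $\gamma_i$ is the surface formed by gluing the boundary of a disk to $\gamma_i$. The dome is orientable if the dome, along with the closures of all of $\gamma_1,\dots,\gamma_r$, forms a closed, orientable surface. Two integral curves (or unions of integral curves) $\gamma$ and $\eta$ are cobordant if there is a dome over $\gamma\cup\eta$, and orientably cobordant if there is such a dome which is orientable. Thus $\gamma$ is orientably cobordant to $\rho_1\cup\dots\cup\rho_k$ if there is an orientable dome over $\gamma\cup\rho_1\cup\dots\cup\rho_k$. *)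

theory Defs
  imports "HOL-Analysis.Analysis"
begin

type_synonym point = "real ^ 3"

text \<open>A closed polygon is the cyclic list of its vertices; vertices may repeat. Its \<open>j\<close>-th edge runs
  from vertex \<open>j\<close> to vertex \<open>j + 1\<close>, the last edge returning to vertex \<open>0\<close>.\<close>

definition edge_start :: "point list \<Rightarrow> nat \<Rightarrow> point" where
  "edge_start c j = c ! j"

definition edge_end :: "point list \<Rightarrow> nat \<Rightarrow> point" where
  "edge_end c j = c ! (Suc j mod length c)"

definition integral_curve :: "point list \<Rightarrow> bool" where
  "integral_curve c \<longleftrightarrow> c \<noteq> [] \<and> (\<forall>j<length c. dist (edge_start c j) (edge_end c j) = 1)"

definition curve_length :: "point list \<Rightarrow> real" where
  "curve_length c = (\<Sum>j<length c. dist (edge_start c j) (edge_end c j))"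

definition integral_curves :: "nat \<Rightarrow> point list set" where
  "integral_curves n = {c. integral_curve c \<and> curve_length c = real n}"

definition unit_rhombi :: "point list set" where
  "unit_rhombi = integral_curves 4"

definition unit_triangle :: "point list \<Rightarrow> bool" where
  "unit_triangle t \<longleftrightarrow> (\<exists>a b c. t = [a, b, c] \<and> dist a b = 1 \<and> dist b c = 1 \<and> dist c a = 1)"

text \<open>Let \<open>F\<close> be a list of closed polygons, each viewed as the boundary of a disk. The side \<open>(i, j)\<close> is
  the \<open>j\<close>-th edge of the \<open>i\<close>-th polygon. Gluing the disks along a fixed-point-free pairing of all
  the sides gives a closed surface: every edge lies on exactly two sides, and since vertices are
  identified only as forced by the edges, every vertex link is a circle. As the surface need not be
  embedded or immersed, the only geometric requirement is that paired sides are the same segment.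
  For unit sides the two endpoints differ, so that segment also determines how they are glued.\<close>

definition sides :: "point list list \<Rightarrow> (nat \<times> nat) set" where
  "sides F = {(i, j). i < length F \<and> j < length (F ! i)}"

definition side_start :: "point list list \<Rightarrow> nat \<times> nat \<Rightarrow> point" where
  "side_start F s = edge_start (F ! fst s) (snd s)"

definition side_end :: "point list list \<Rightarrow> nat \<times> nat \<Rightarrow> point" where
  "side_end F s = edge_end (F ! fst s) (snd s)"

definition closed_gluing :: "point list list \<Rightarrow> (nat \<times> nat \<Rightarrow> nat \<times> nat) \<Rightarrow> bool" where
  "closed_gluing F \<alpha> \<longleftrightarrow>
     (\<forall>s\<in>sides F. \<alpha> s \<in> sides F \<and> \<alpha> s \<noteq> s \<and> \<alpha> (\<alpha> s) = s \<and>
        {side_start F (\<alpha> s), side_end F (\<alpha> s)} = {side_start F s, side_end F s})"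

text \<open>An orientation \<open>\<epsilon>\<close> says for each face whether its boundary is traversed in the order of the list
  or in the opposite order. The glued surface is orientable iff the faces can be oriented so that
  any two glued sides are traversed in opposite directions.\<close>

definition oriented_side :: "point list list \<Rightarrow> (nat \<Rightarrow> bool) \<Rightarrow> nat \<times> nat \<Rightarrow> point \<times> point" where
  "oriented_side F \<epsilon> s =
     (if \<epsilon> (fst s) then (side_start F s, side_end F s) else (side_end F s, side_start F s))"

definition orientable_gluing :: "point list list \<Rightarrow> (nat \<times> nat \<Rightarrow> nat \<times> nat) \<Rightarrow> bool" where
  "orientable_gluing F \<alpha> \<longleftrightarrow>
     (\<exists>\<epsilon>. \<forall>s\<in>sides F. oriented_side F \<epsilon> (\<alpha> s) = prod.swap (oriented_side F \<epsilon> s))"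

text \<open>A dome over the curves \<open>\<Gamma>\<close> is given by its triangles \<open>T\<close> and a gluing \<open>\<alpha>\<close> that turns these,
  together with one closing disk for every curve of \<open>\<Gamma>\<close>, into a closed surface. Two sides of closing
  disks may be glued to each other: these are the edges of the dome that lie in no triangle.\<close>

definition dome ::
  "point list list \<Rightarrow> (nat \<times> nat \<Rightarrow> nat \<times> nat) \<Rightarrow> point list list \<Rightarrow> bool" where
  "dome T \<alpha> \<Gamma> \<longleftrightarrow>
     (\<forall>t\<in>set T. unit_triangle t) \<and> (\<forall>c\<in>set \<Gamma>. integral_curve c) \<and> closed_gluing (T @ \<Gamma>) \<alpha>"

definition orientable_dome ::
  "point list list \<Rightarrow> (nat \<times> nat \<Rightarrow> nat \<times> nat) \<Rightarrow> point list list \<Rightarrow> bool" where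
  "orientable_dome T \<alpha> \<Gamma> \<longleftrightarrow> dome T \<alpha> \<Gamma> \<and> orientable_gluing (T @ \<Gamma>) \<alpha>"

text \<open>Both arguments are finite unions of curves, given as lists.\<close>

definition orientably_cobordant :: "point list list \<Rightarrow> point list list \<Rightarrow> bool" where
  "orientably_cobordant \<Gamma> \<Delta> \<longleftrightarrow> (\<exists>T \<alpha>. orientable_dome T \<alpha> (\<Gamma> @ \<Delta>))"

end

theory Submission
  imports Defs "HOL-Library.Function_Algebras" "HOL-Library.Multiset"
begin

text \<open>Only the 1-chain of oriented edges matters: if the boundaries of some oriented polygons add up to
  zero, their sides can be glued in oppositely oriented pairs. So it suffices to write the boundary of
  \<open>\<gamma>\<close> as a sum of boundaries of unit triangles and unit rhombi.

  Regard \<open>\<gamma>\<close> as a closed walk with unit steps. Replacing two consecutive steps \<open>u, v\<close> by unit steps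
  \<open>u', v'\<close> with \<open>u' + v' = u + v\<close> (in particular swapping them) costs one rhombus, and merging two steps
  whose sum is a unit vector costs only a triangle. As the steps add up to zero, there are three of
  them whose pairwise inner products have a sum \<open>\<le> 0\<close>. Among these some pair \<open>a, b\<close> can be rotated about
  \<open>a + b\<close> until one of its members is at angle 120 degrees to the third step \<open>c\<close> and can be merged with it.
  Moving the three steps together takes at most \<open>2n - 5\<close> swaps for a walk of length \<open>n\<close>, so passing
  from \<open>n\<close> to \<open>n - 1\<close> steps costs \<open>2n - 4\<close> rhombi, and \<open>n(n - 3)\<close> rhombi suffice in total. Degenerate rhombi
  \<open>a, b, a, b\<close>, whose boundary is zero, bring their number up to \<open>n\<^sup>2 + 2n - 12\<close>.\<close>

subsection \<open>Chains bounded by triangles and rhombi\<close>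

text \<open>Antisymmetric functions on ordered pairs of points: an edge and its reverse cancel
  without a choice of orientations.\<close>

definition edge_chain :: "point \<Rightarrow> point \<Rightarrow> point \<times> point \<Rightarrow> int" where
  "edge_chain p q z = of_bool ((p, q) = z) - of_bool ((p, q) = prod.swap z)"

definition boundary :: "point list \<Rightarrow> point \<times> point \<Rightarrow> int" where
  "boundary c = (\<Sum>j<length c. edge_chain (edge_start c j) (edge_end c j))"

text \<open>The rhombi are counted exactly, the triangles not at all. Signs are unnecessary, since
  reversing a polygon negates its boundary (\<open>filling_minus\<close>).\<close>

definition filling :: "nat \<Rightarrow> (point \<times> point \<Rightarrow> int) \<Rightarrow> bool" where
  "filling k f \<longleftrightarrow> (\<exists>T R. (\<forall>t\<in>set T. unit_triangle t) \<and> set R \<subseteq> unit_rhombi \<and> length R = k \<and>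
     f = sum_list (map boundary (T @ R)))"

lemma edge_chain_flip: "edge_chain q p = - edge_chain p q"
proof
  fix z
  have "(q, p) = z \<longleftrightarrow> (p, q) = prod.swap z" "(q, p) = prod.swap z \<longleftrightarrow> (p, q) = z"
    by (cases z; auto)+
  then show "edge_chain q p z = (- edge_chain p q) z"
    by (simp add: edge_chain_def)
qed

lemma boundary_triangle: "boundary [a, b, c] = edge_chain a b + edge_chain b c + edge_chain c a"
  by (simp add: boundary_def edge_start_def edge_end_def add_ac)

lemma boundary_quadrilateral:
  "boundary [a, b, c, d] = edge_chain a b + edge_chain b c + edge_chain c d + edge_chain d a"
  by (simp add: boundary_def edge_start_def edge_end_def add_ac)

lemma curve_length_eq: "integral_curve c \<Longrightarrow> curve_length c = length c"
  by (simp add: integral_curve_def curve_length_def)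

lemma integral_curve_triple:
  "integral_curve [a, b, c] \<longleftrightarrow> dist a b = 1 \<and> dist b c = 1 \<and> dist c a = 1"
  by (auto simp: integral_curve_def edge_start_def edge_end_def All_less_Suc)

lemma integral_curve_quadruple:
  "integral_curve [a, b, c, d] \<longleftrightarrow> dist a b = 1 \<and> dist b c = 1 \<and> dist c d = 1 \<and> dist d a = 1"
  by (auto simp: integral_curve_def edge_start_def edge_end_def All_less_Suc)

lemma unit_rhombus_iff:
  "r \<in> unit_rhombi \<longleftrightarrow>
    (\<exists>a b c d. r = [a, b, c, d] \<and> dist a b = 1 \<and> dist b c = 1 \<and> dist c d = 1 \<and> dist d a = 1)"
proof -
  have "r \<in> unit_rhombi \<longleftrightarrow> integral_curve r \<and> length r = 4"
    using curve_length_eq[of r] by (auto simp: unit_rhombi_def integral_curves_def)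
  also have "length r = 4 \<longleftrightarrow> (\<exists>a b c d. r = [a, b, c, d])"
    by (auto simp: eval_nat_numeral length_Suc_conv)
  finally show ?thesis using integral_curve_quadruple by metis
qed

lemma filling_zero: "filling 0 0"
  unfolding filling_def by (intro exI[of _ "[]"]) auto

lemma filling_triangle: "unit_triangle t \<Longrightarrow> filling 0 (boundary t)"
  unfolding filling_def by (intro exI[of _ "[t]"] exI[of _ "[]"]) auto

lemma filling_rhombus: "r \<in> unit_rhombi \<Longrightarrow> filling 1 (boundary r)"
  unfolding filling_def by (intro exI[of _ "[]"] exI[of _ "[r]"]) auto

lemma filling_add:
  assumes "filling k f" "filling l g"
  shows "filling (k + l) (f + g)"
proof -
  obtain T R where 1: "\<forall>t\<in>set T. unit_triangle t" "set R \<subseteq> unit_rhombi" "length R = k"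
    "f = sum_list (map boundary (T @ R))"
    using assms(1) unfolding filling_def by blast
  obtain T' R' where 2: "\<forall>t\<in>set T'. unit_triangle t" "set R' \<subseteq> unit_rhombi" "length R' = l"
    "g = sum_list (map boundary (T' @ R'))"
    using assms(2) unfolding filling_def by blast
  show ?thesis
    unfolding filling_def
  proof (intro exI conjI)
    show "\<forall>t\<in>set (T @ T'). unit_triangle t" using 1(1) 2(1) by auto
    show "set (R @ R') \<subseteq> unit_rhombi" using 1(2) 2(2) by simp
    show "length (R @ R') = k + l" using 1(3) 2(3) by simp
    show "f + g = sum_list (map boundary ((T @ T') @ (R @ R')))"
      unfolding 1(4) 2(4) by (simp only: map_append sum_list_append add_ac)
  qed
qed

lemma filling_minus:
  assumes "filling k f"
  shows "filling k (- f)"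
proof -
  obtain T R where 1: "\<forall>t\<in>set T. unit_triangle t" "set R \<subseteq> unit_rhombi" "length R = k"
    "f = sum_list (map boundary (T @ R))"
    using assms unfolding filling_def by blast
  have t: "unit_triangle (rev t) \<and> boundary (rev t) = - boundary t" if tT: "t \<in> set T" for t
  proof -
    obtain a b c where "t = [a, b, c]" "dist a b = 1" "dist b c = 1" "dist c a = 1"
      using 1(1) tT by (auto simp: unit_triangle_def)
    then show ?thesis
      by (simp add: unit_triangle_def boundary_triangle dist_commute edge_chain_flip[of b a]
          edge_chain_flip[of c b] edge_chain_flip[of a c] algebra_simps)
  qed
  have r: "rev r \<in> unit_rhombi \<and> boundary (rev r) = - boundary r" if rR: "r \<in> set R" for r
  proof -
    from rR 1(2) have "r \<in> unit_rhombi" by (rule rev_subsetD)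
    then obtain a b c d where "r = [a, b, c, d]" "dist a b = 1" "dist b c = 1" "dist c d = 1"
      "dist d a = 1"
      by (subst (asm) unit_rhombus_iff) (elim exE conjE)
    then show ?thesis
      by (simp add: unit_rhombus_iff boundary_quadrilateral dist_commute edge_chain_flip[of b a]
          edge_chain_flip[of c b] edge_chain_flip[of d c] edge_chain_flip[of a d]
          algebra_simps)
  qed
  have "map boundary (map rev T @ map rev R) = map (uminus \<circ> boundary) (T @ R)"
    using t r by simp
  then have "- f = sum_list (map boundary (map rev T @ map rev R))"
    unfolding 1(4) by (simp only: uminus_sum_list_map)
  moreover have "\<forall>t\<in>set (map rev T). unit_triangle t" "set (map rev R) \<subseteq> unit_rhombi"
    using t r by auto
  moreover have "length (map rev R) = k" using 1(3) by simp
  ultimately show ?thesis unfolding filling_def by blast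
qed

lemma filling_diff_trans: "filling k (f - g) \<Longrightarrow> filling l (g - h) \<Longrightarrow> filling (k + l) (f - h)"
  by (drule (1) filling_add) simp

lemma filling_diff_sym: "filling k (f - g) \<Longrightarrow> filling k (g - f)"
  by (drule filling_minus) simp

lemma filling_mono:
  assumes "filling k f" "k \<le> l"
  shows "filling l f"
proof -
  let ?a = "0 :: point" and ?b = "axis 1 1 :: point"
  have "boundary [?a, ?b, ?a, ?b] = 0"
    using edge_chain_flip[of ?a ?b] by (simp add: boundary_quadrilateral)
  moreover have "[?a, ?b, ?a, ?b] \<in> unit_rhombi"
    by (simp add: unit_rhombus_iff dist_norm norm_axis_1)
  ultimately have "filling 1 0"
    using filling_rhombus by force
  show ?thesis
    using \<open>k \<le> l\<close>
  proof (induction rule: dec_induct)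
    case base
    then show ?case by (rule assms)
  next
    case (step m)
    then show ?case
      using filling_add[OF step.IH \<open>filling 1 0\<close>] by simp
  qed
qed

subsection \<open>From chains to gluings\<close>

text \<open>The gluing is built by pairing sides greedily: balance provides a partner for any side, and
  removing both keeps the remaining sides balanced.\<close>

lemma balanced_pairing:
  fixes o' :: "'a \<Rightarrow> 'b \<times> 'b"
  assumes "finite D"
    and "\<And>z. card {s \<in> D. o' s = z} = card {s \<in> D. o' s = prod.swap z}"
    and "\<And>s. s \<in> D \<Longrightarrow> o' s \<noteq> prod.swap (o' s)"
  shows "\<exists>\<alpha>. \<forall>s\<in>D. \<alpha> s \<in> D \<and> \<alpha> s \<noteq> s \<and> \<alpha> (\<alpha> s) = s \<and> o' (\<alpha> s) = prod.swap (o' s)"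
  using assms
proof (induction "card D" arbitrary: D rule: less_induct)
  case less
  show ?case
  proof (cases "D = {}")
    case False
    then obtain s where s: "s \<in> D" by auto
    have "card {x \<in> D. o' x = o' s} > 0"
      using s less.prems(1) by (auto simp: card_gt_0_iff)
    then have "card {x \<in> D. o' x = prod.swap (o' s)} > 0"
      using less.prems(2) by simp
    then obtain s' where s': "s' \<in> D" "o' s' = prod.swap (o' s)"
      by (auto simp: card_gt_0_iff)
    have ne: "s' \<noteq> s" using s s' less.prems(3) by auto
    let ?D = "D - {s, s'}"
    \<comment> \<open>Removing \<open>s\<close> and \<open>s'\<close> lowers the count of a label
      once for each of the two that carries it. Their labels are swaps of each other, so the counts
      for \<open>z\<close> and \<open>prod.swap z\<close> together remain balanced.\<close>
    have split: "card {x \<in> D. o' x = z} =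
        card {x \<in> ?D. o' x = z} + (of_bool (o' s = z) + of_bool (o' s' = z))" for z
    proof -
      have "{x \<in> D. o' x = z} = {x \<in> ?D. o' x = z} \<union> {x \<in> {s, s'}. o' x = z}"
        using s s' by auto
      moreover have "card \<dots> = card {x \<in> ?D. o' x = z} + card {x \<in> {s, s'}. o' x = z}"
        using less.prems(1) by (intro card_Un_disjoint) auto
      moreover have "card {x \<in> {s, s'}. o' x = z} = of_bool (o' s = z) + of_bool (o' s' = z)"
        using ne by (simp add: Collect_conv_if conj_disj_distribR Collect_disj_eq)
      ultimately show ?thesis by simp
    qed
    have "card {x \<in> ?D. o' x = z} = card {x \<in> ?D. o' x = prod.swap z}" for z
    proof -
      have "o' s = prod.swap z \<longleftrightarrow> o' s' = z" "o' s' = prod.swap z \<longleftrightarrow> o' s = z"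
        using s' by (metis swap_swap)+
      then show ?thesis
        using less.prems(2)[of z] split[of z] split[of "prod.swap z"] by simp
    qed
    moreover have "card ?D < card D"
      using s less.prems(1) by (intro psubset_card_mono) auto
    ultimately obtain \<alpha> where \<alpha>: "\<forall>x\<in>?D. \<alpha> x \<in> ?D \<and> \<alpha> x \<noteq> x \<and> \<alpha> (\<alpha> x) = x \<and> o' (\<alpha> x) = prod.swap (o' x)"
      using less.hyps[of ?D] less.prems by auto
    show ?thesis
      by (rule exI[of _ "\<alpha>(s := s', s' := s)"]) (use \<alpha> s s' ne in auto)
  qed auto
qed

lemma sides_eq_Sigma: "sides F = Sigma {..<length F} (\<lambda>i. {..<length (F ! i)})"
  by (auto simp: sides_def)

lemma sum_sides:
  fixes f :: "nat \<times> nat \<Rightarrow> 'a::comm_monoid_add"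
  shows "(\<Sum>s\<in>sides F. f s) = (\<Sum>i<length F. \<Sum>j<length (F ! i). f (i, j))"
  by (simp add: sides_eq_Sigma sum.Sigma)

lemma finite_sides: "finite (sides F)"
  by (simp add: sides_eq_Sigma)

lemma sum_fun_apply: "(\<Sum>s\<in>A. f s) z = (\<Sum>s\<in>A. f s z)"
  by (induction A rule: infinite_finite_induct) auto

lemma orientable_gluing_of_boundary:
  assumes "\<And>c. c \<in> set F \<Longrightarrow> integral_curve c"
    and "sum_list (map boundary F) = 0"
  obtains \<alpha> where "closed_gluing F \<alpha>" "orientable_gluing F \<alpha>"
proof -
  define o' where "o' s = (side_start F s, side_end F s)" for s
  have sum0: "(\<Sum>s\<in>sides F. edge_chain (side_start F s) (side_end F s)) = 0"
    using assms(2) by (simp add: sum_sides sum_list_sum_nth boundary_def side_start_def side_end_def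
        atLeast0LessThan)
  \<comment> \<open>The vanishing chain, evaluated at \<open>z\<close>, is the number of sides
    running along \<open>z\<close> minus the number running along its reverse.\<close>
  have bal: "card {s \<in> sides F. o' s = z} = card {s \<in> sides F. o' s = prod.swap z}" for z
  proof -
    have "0 = (\<Sum>s\<in>sides F. edge_chain (side_start F s) (side_end F s)) z"
      by (simp add: sum0)
    also have "\<dots> = (\<Sum>s\<in>sides F. edge_chain (side_start F s) (side_end F s) z)"
      by (rule sum_fun_apply)
    also have "\<dots> = (\<Sum>s\<in>sides F. of_bool (o' s = z) - of_bool (o' s = prod.swap z))"
      by (simp only: edge_chain_def o'_def)
    also have "\<dots> = int (card {s \<in> sides F. o' s = z}) - int (card {s \<in> sides F. o' s = prod.swap z})"
      using finite_sides[of F] by (simp add: sum_subtractf Int_def)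
    finally show ?thesis by simp
  qed
  have ne: "o' s \<noteq> prod.swap (o' s)" if "s \<in> sides F" for s
  proof -
    have "dist (side_start F s) (side_end F s) = 1"
      using that assms(1)[of "F ! fst s"]
      by (auto simp: sides_def side_start_def side_end_def integral_curve_def)
    then show ?thesis by (auto simp: o'_def)
  qed
  have "\<exists>\<alpha>. \<forall>s\<in>sides F. \<alpha> s \<in> sides F \<and> \<alpha> s \<noteq> s \<and> \<alpha> (\<alpha> s) = s \<and>
      o' (\<alpha> s) = prod.swap (o' s)"
    by (intro balanced_pairing finite_sides bal ne)
  then obtain \<alpha> where \<alpha>: "\<forall>s\<in>sides F. \<alpha> s \<in> sides F \<and> \<alpha> s \<noteq> s \<and> \<alpha> (\<alpha> s) = s \<and>
      o' (\<alpha> s) = prod.swap (o' s)"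
    by (elim exE)
  have "closed_gluing F \<alpha>"
    unfolding closed_gluing_def
  proof (intro ballI conjI)
    fix s
    assume "s \<in> sides F"
    with \<alpha> have s: "\<alpha> s \<in> sides F" "\<alpha> s \<noteq> s" "\<alpha> (\<alpha> s) = s" "o' (\<alpha> s) = prod.swap (o' s)"
      by blast+
    then show "\<alpha> s \<in> sides F" "\<alpha> s \<noteq> s" "\<alpha> (\<alpha> s) = s" by blast+
    show "{side_start F (\<alpha> s), side_end F (\<alpha> s)} = {side_start F s, side_end F s}"
      using s(4) by (simp add: o'_def insert_commute)
  qed
  \<comment> \<open>Paired sides already run oppositely in list order, so no face has to be
    reversed.\<close>
  moreover have "orientable_gluing F \<alpha>"
    unfolding orientable_gluing_def oriented_side_def
    by (rule exI[of _ "\<lambda>_. True"]) (use \<alpha> in \<open>simp add: o'_def\<close>)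
  ultimately show ?thesis by (rule that)
qed

lemma integral_curve_triangle: "unit_triangle t \<Longrightarrow> integral_curve t"
  by (auto simp: unit_triangle_def integral_curve_triple)

lemma orientably_cobordant_of_filling:
  assumes "integral_curve \<gamma>" "filling k (boundary \<gamma>)"
  shows "\<exists>\<rho>s. length \<rho>s = k \<and> set \<rho>s \<subseteq> unit_rhombi \<and> orientably_cobordant [\<gamma>] \<rho>s"
proof -
  \<comment> \<open>Filling the negated boundary lets \<gamma> enter the surface in its own
    direction, so that all boundaries add up to zero.\<close>
  obtain T R where 1: "\<forall>t\<in>set T. unit_triangle t" "set R \<subseteq> unit_rhombi" "length R = k"
    "- boundary \<gamma> = sum_list (map boundary (T @ R))"
    using filling_minus[OF assms(2)] unfolding filling_def by blast
  let ?F = "T @ [\<gamma>] @ R"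
  have R: "integral_curve c" if "c \<in> set R" for c
    using that 1(2) by (auto simp: unit_rhombi_def integral_curves_def)
  have F: "integral_curve c" if "c \<in> set ?F" for c
    using that 1(1) R assms(1) integral_curve_triangle by auto
  have "sum_list (map boundary ?F) = boundary \<gamma> + sum_list (map boundary (T @ R))"
    by (simp add: algebra_simps)
  then have "sum_list (map boundary ?F) = 0"
    using 1(4) by (metis add.right_inverse)
  with F obtain \<alpha> where "closed_gluing ?F \<alpha>" "orientable_gluing ?F \<alpha>"
    by (rule orientable_gluing_of_boundary)
  then have "orientable_dome T \<alpha> ([\<gamma>] @ R)"
    using 1(1) F unfolding orientable_dome_def dome_def by simp
  then have "orientably_cobordant [\<gamma>] R"
    unfolding orientably_cobordant_def by blast
  then show ?thesis using 1 by blast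
qed

subsection \<open>Walks\<close>

text \<open>Recording steps instead of vertices makes swaps local. No closing edge is added; the
  walk is closed when its steps sum to zero.\<close>

fun walk :: "point \<Rightarrow> point list \<Rightarrow> point \<times> point \<Rightarrow> int" where
  "walk p [] = 0"
| "walk p (u # us) = edge_chain p (p + u) + walk (p + u) us"

lemma walk_append: "walk p (us @ vs) = walk p us + walk (p + sum_list us) vs"
  by (induction us arbitrary: p) (auto simp: algebra_simps)

text \<open>A closed walk may be started at any of its vertices, so cyclic rotation costs no
  rhombi.\<close>

lemma walk_rotate:
  "sum_list (us @ vs) = 0 \<Longrightarrow> walk p (us @ vs) = walk (p + sum_list us) (vs @ us)"
proof -
  assume "sum_list (us @ vs) = 0"
  then have "p + sum_list us + sum_list vs = p" by (simp add: add.assoc)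
  then show ?thesis unfolding walk_append by (simp only: add.commute[of "walk p us"])
qed

lemma walk_conv_sum:
  "walk p us = (\<Sum>j<length us. edge_chain (p + sum_list (take j us)) (p + sum_list (take (Suc j) us)))"
  by (induction us arbitrary: p) (auto simp: sum.lessThan_Suc_shift add.assoc simp del: sum.lessThan_Suc)

text \<open>Two two-step paths with common ends form a unit rhombus. The choice
  \<open>u' = v\<close>, \<open>v' = u\<close> swaps neighbouring steps.\<close>

lemma filling_replace_pair:
  assumes "norm u = 1" "norm v = 1" "norm u' = 1" "norm v' = 1" "u + v = u' + v'"
  shows "filling 1 (walk p (xs @ u # v # ys) - walk p (xs @ u' # v' # ys))"
proof -
  let ?q = "p + sum_list xs"
  have v: "?q + u + v = ?q + u' + v'"
    using assms(5) by (simp add: add.assoc)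
  let ?r = "[?q, ?q + u, ?q + u + v, ?q + u']"
  have "dist (?q + u + v) (?q + u') = 1"
    unfolding v using assms by (simp add: dist_norm)
  then have "?r \<in> unit_rhombi"
    unfolding unit_rhombus_iff using assms by (auto simp: dist_norm)
  moreover have "boundary ?r = walk p (xs @ u # v # ys) - walk p (xs @ u' # v' # ys)"
    using edge_chain_flip[of "?q + u'" ?q] edge_chain_flip[of "?q + u' + v'" "?q + u'"]
    by (simp add: walk_append boundary_quadrilateral v)
  ultimately show ?thesis using filling_rhombus by metis
qed

lemma filling_merge:
  assumes "norm u = 1" "norm v = 1" "norm (u + v) = 1"
  shows "filling 0 (walk p (u # v # ys) - walk p ((u + v) # ys))"
proof -
  let ?t = "[p, p + u, p + u + v]"
  have "dist (p + u + v) p = 1"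
    using assms by (simp add: dist_norm add.assoc)
  then have "unit_triangle ?t"
    unfolding unit_triangle_def using assms by (auto simp: dist_norm)
  moreover have "boundary ?t = walk p (u # v # ys) - walk p ((u + v) # ys)"
    using edge_chain_flip[of "p + (u + v)" p] by (simp add: boundary_triangle add.assoc)
  ultimately show ?thesis using filling_triangle by metis
qed

text \<open>One swap for each step of \<open>ys\<close> that \<open>u\<close> passes.\<close>

lemma filling_move:
  assumes "norm u = 1" "\<forall>x\<in>set ys. norm x = 1"
  shows "filling (length ys) (walk p (xs @ ys @ u # zs) - walk p (xs @ u # ys @ zs))"
  using assms(2)
proof (induction ys arbitrary: zs rule: rev_induct)
  case Nil
  then show ?case by (simp add: filling_zero flip: zero_fun_def)
next
  case (snoc y ys)
  have "filling 1 (walk p ((xs @ ys) @ y # u # zs) - walk p ((xs @ ys) @ u # y # zs))"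
    using snoc.prems assms(1) by (intro filling_replace_pair) (auto simp: add.commute)
  moreover have "filling (length ys) (walk p (xs @ ys @ u # y # zs) - walk p (xs @ u # ys @ y # zs))"
    using snoc.IH snoc.prems by (simp add: fun_diff_def)
  ultimately have "filling (1 + length ys)
      (walk p (xs @ ys @ y # u # zs) - walk p (xs @ u # ys @ y # zs))"
    unfolding append_assoc by (rule filling_diff_trans)
  then show ?case by (simp add: fun_diff_def)
qed

lemma filling_triple_to_front:
  assumes "mset us = add_mset c (add_mset a (add_mset b M))"
    and "\<forall>u\<in>set us. norm u = 1" "sum_list us = 0"
  obtains q rest where "mset rest = M"
    "filling (2 * size M + 1) (walk p us - walk q (c # a # b # rest))"
proof -
  have "c \<in># mset us" by (simp add: assms(1))
  then have "c \<in> set us" by simp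
  then obtain xs ys where us: "us = xs @ c # ys" by (meson split_list)
  let ?q = "p + sum_list xs" and ?zs = "ys @ xs"
  \<comment> \<open>Rotation brings \<open>c\<close> to the front for free; only \<open>a\<close>
    and \<open>b\<close> have to be moved by swaps.\<close>
  have rot: "walk p us = walk ?q (c # ?zs)"
    using walk_rotate[of xs "c # ys" p] assms(3) us by simp
  have zs: "mset ?zs = add_mset a (add_mset b M)" using assms(1) us by (simp add: union_commute)
  then have "a \<in># mset ?zs" by simp
  then have "a \<in> set ?zs" by simp
  then obtain A B where A: "?zs = A @ a # B" by (meson split_list)
  have AB: "mset (A @ B) = add_mset b M" using zs A by simp
  then have "b \<in># mset (A @ B)" by simp
  then have "b \<in> set (A @ B)" by simp
  then obtain C D where C: "A @ B = C @ b # D" by (meson split_list)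
  have CD: "mset (C @ D) = M" using AB C by simp
  have sub: "set ?zs \<subseteq> set us" by (auto simp: us)
  then have unit: "\<forall>x\<in>set A \<union> set B. norm x = 1" "norm a = 1"
    using assms(2) unfolding A by auto
  then have unitC: "\<forall>x\<in>set C. norm x = 1" "norm b = 1"
    using arg_cong[OF C, of set] by auto
  have "filling (length A) (walk ?q (c # A @ a # B) - walk ?q (c # a # A @ B))"
    using filling_move[OF unit(2), of A ?q "[c]" B] unit(1) by (simp del: walk.simps)
  moreover have "filling (length C) (walk ?q (c # a # C @ b # D) - walk ?q (c # a # b # C @ D))"
    using filling_move[OF unitC(2,1), of ?q "[c, a]" D] by (simp del: walk.simps)
  ultimately have *: "filling (length A + length C) (walk p us - walk ?q (c # a # b # C @ D))"
    unfolding rot A C by (rule filling_diff_trans)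
  have "size (mset (A @ B)) = size M + 1" "size (mset (C @ D)) = size M"
    unfolding AB CD by simp_all
  \<comment> \<open>On its way \<open>a\<close> passes at most \<open>b\<close> and the steps in
    \<open>M\<close>, while \<open>b\<close> passes only steps in \<open>M\<close>.\<close>
  then have "length A + length C \<le> 2 * size M + 1" by simp
  from CD filling_mono[OF * this] show ?thesis by (rule that)
qed

subsection \<open>Three unit vectors with nonpositive sum of inner products\<close>

lemma exists_nonpos_inner:
  fixes d :: "'a::real_inner"
  assumes "d \<bullet> sum_list xs \<le> 0" "xs \<noteq> []"
  obtains x where "x \<in> set xs" "d \<bullet> x \<le> 0"
proof -
  have "\<not> (\<forall>x\<in>set xs. d \<bullet> x > 0)"
  proof
    assume "\<forall>x\<in>set xs. d \<bullet> x > 0"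
    with \<open>xs \<noteq> []\<close> have "d \<bullet> sum_list xs > 0"
    proof (induction xs rule: list_nonempty_induct)
      case (cons x xs)
      then show ?case by (auto simp: inner_add_right intro!: add_pos_pos)
    qed simp
    with assms(1) show False by simp
  qed
  then show ?thesis using that by force
qed

text \<open>Greedy choice: the steps other than \<open>u\<close> sum to \<open>- u\<close>, so one
  of them, \<open>v\<close>, has nonpositive inner product with \<open>u\<close>. The others then
  sum to \<open>- (u + v)\<close>, which yields \<open>w\<close> in the same way.\<close>

lemma exists_obtuse_triple:
  fixes us :: "'a::real_inner list"
  assumes "sum_list us = 0" "\<forall>u\<in>set us. norm u = 1" "length us \<ge> 3"
  obtains u v w M where "mset us = {#u, v, w#} + M" "u \<bullet> v + u \<bullet> w + v \<bullet> w \<le> 0"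
proof -
  obtain u xs where us: "us = u # xs" using assms(3) by (cases us) auto
  have s: "sum_list xs = - u" using assms(1) us by (simp add: eq_neg_iff_add_eq_0 add.commute)
  have "u \<bullet> sum_list xs \<le> 0" "xs \<noteq> []" using assms(3) us by (auto simp: s)
  then obtain v where v: "v \<in> set xs" "u \<bullet> v \<le> 0" by (rule exists_nonpos_inner)
  then obtain A B where xs: "xs = A @ v # B" by (meson split_list)
  have s': "sum_list (A @ B) = - (u + v)"
    using s unfolding xs by (simp add: algebra_simps)
  have "(u + v) \<bullet> sum_list (A @ B) \<le> 0" "A @ B \<noteq> []"
    using assms(3) us xs by (auto simp only: s' inner_minus_right neg_le_0_iff_le inner_ge_zero) auto
  then obtain w where w: "w \<in> set (A @ B)" "(u + v) \<bullet> w \<le> 0" by (rule exists_nonpos_inner)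
  then obtain C D where C: "A @ B = C @ w # D" by (meson split_list)
  have "mset us = {#u, v, w#} + mset (C @ D)"
    using arg_cong[OF C, of mset] us xs by simp
  moreover have "u \<bullet> v + u \<bullet> w + v \<bullet> w \<le> 0"
    using v w by (simp add: inner_add_left)
  ultimately show ?thesis by (rule that)
qed

text \<open>The hypothesis says that the Gram determinant that \<open>d\<close>, \<open>c\<close> and the sought vector \<open>x\<close> would
  have is nonnegative.\<close>

lemma exists_unit_with_inner:
  fixes c d :: point
  assumes "norm c = 1"
    and "4 * (d \<bullet> c)\<^sup>2 + 2 * (d \<bullet> d) * (d \<bullet> c) \<le> (d \<bullet> d) * (3 - d \<bullet> d)"
  obtains x where "norm x = 1" "x \<bullet> d = (d \<bullet> d) / 2" "x \<bullet> c = - 1 / 2"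
proof -
  define \<delta> t where "\<delta> = d \<bullet> d" and "t = d \<bullet> c"
  \<comment> \<open>The Gram determinant of \<open>c\<close> and \<open>d\<close>, zero exactly when
    \<open>d\<close> is a multiple of the unit vector \<open>c\<close>.\<close>
  define D where "D = \<delta> - t\<^sup>2"
  have cc: "c \<bullet> c = 1" using assms(1) by (simp add: norm_eq_1)
  have hyp: "4 * t\<^sup>2 + 2 * \<delta> * t \<le> \<delta> * (3 - \<delta>)" using assms(2) by (simp add: \<delta>_def t_def)
  have D': "D = (d - t *\<^sub>R c) \<bullet> (d - t *\<^sub>R c)"
    by (simp add: D_def \<delta>_def t_def inner_diff cc inner_commute power2_eq_square)
  then have "D \<ge> 0" by simp
  show ?thesis
  proof (cases "D = 0")
    case True
    then have d: "d = t *\<^sub>R c" using D' by simp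
    have "\<delta> = t\<^sup>2" using True D_def by simp
    \<comment> \<open>Only \<open>d = 0\<close> and \<open>d = - c\<close> remain. In both cases the
      condition on \<open>x \<bullet> d\<close> follows from \<open>x \<bullet> c = - 1 / 2\<close>,
      so any unit vector at 120 degrees to \<open>c\<close> will do.\<close>
    then have "(t * (t + 1))\<^sup>2 \<le> 0"
      using hyp by (simp add: algebra_simps power2_eq_square)
    then have t: "t * (t + 1) = 0" by (simp only: power2_less_eq_zero_iff)
    obtain y :: point where y: "y \<noteq> 0" "orthogonal c y"
      using orthogonal_to_vector_exists[of c] by auto
    define z where "z = y /\<^sub>R norm y"
    have z: "z \<bullet> z = 1" "z \<bullet> c = 0" "c \<bullet> z = 0"
      using y by (auto simp: z_def orthogonal_def inner_commute dot_square_norm power2_eq_square)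
    let ?x = "(- 1 / 2) *\<^sub>R c + (sqrt 3 / 2) *\<^sub>R z"
    have "?x \<bullet> ?x = 1"
      by (simp add: inner_add inner_diff cc z)
    moreover have xc: "?x \<bullet> c = - 1 / 2" by (simp add: inner_add inner_diff cc z)
    moreover have "?x \<bullet> d = \<delta> / 2"
      using t unfolding d inner_scaleR_right xc \<open>\<delta> = t\<^sup>2\<close>
      by (simp add: algebra_simps power2_eq_square)
    ultimately show ?thesis using that unfolding \<delta>_def by (metis norm_eq_1)
  next
    case False
    with \<open>D \<ge> 0\<close> have "D > 0" by simp
    obtain n where n: "n \<bullet> d = 0" "n \<bullet> c = 0" "n \<bullet> n = D"
    proof
      show "cross3 c d \<bullet> d = 0" "cross3 c d \<bullet> c = 0"
        by (simp_all add: dot_cross_self)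
      show "cross3 c d \<bullet> cross3 c d = D"
        by (simp add: dot_cross cc D_def \<delta>_def t_def inner_commute power2_eq_square)
    qed
    \<comment> \<open>Cramer's rule for the two linear equations in \<open>eq\<close>, whose
      determinant is \<open>D\<close>.\<close>
    define \<alpha> \<beta> where "\<alpha> = (\<delta> + t) / (2 * D)" and "\<beta> = - \<delta> * (1 + t) / (2 * D)"
    have eq: "\<alpha> * \<delta> + \<beta> * t = \<delta> / 2" "\<alpha> * t + \<beta> = - 1 / 2"
    proof -
      have "\<alpha> * \<delta> + \<beta> * t = \<delta> * D / (2 * D)"
        by (simp add: \<alpha>_def \<beta>_def D_def power2_eq_square algebra_simps add_divide_distrib diff_divide_distrib)
      then show "\<alpha> * \<delta> + \<beta> * t = \<delta> / 2" using \<open>D > 0\<close> by simp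
      have "\<alpha> * t + \<beta> = - D / (2 * D)"
        by (simp add: \<alpha>_def \<beta>_def D_def power2_eq_square algebra_simps add_divide_distrib diff_divide_distrib)
      then show "\<alpha> * t + \<beta> = - 1 / 2" using \<open>D > 0\<close> by simp
    qed
    \<comment> \<open>The squared norm of the component of \<open>x\<close> in the plane of
      \<open>c\<close> and \<open>d\<close>. The hypothesis amounts to \<open>m \<le> 1\<close>, and
      a multiple of the normal \<open>n\<close> supplies the missing length.\<close>
    define m where "m = \<alpha> * \<delta> / 2 - \<beta> / 2"
    have "m = \<delta> * (\<delta> + 1 + 2 * t) / (4 * D)"
      using \<open>D > 0\<close> by (simp add: m_def \<alpha>_def \<beta>_def field_simps)
    moreover have "\<delta> * (\<delta> + 1 + 2 * t) \<le> 4 * D"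
      using hyp by (simp add: D_def algebra_simps)
    ultimately have "m \<le> 1" using \<open>D > 0\<close> by simp
    define \<eta> where "\<eta> = sqrt ((1 - m) / D)"
    have \<eta>: "\<eta> * \<eta> * D = 1 - m" using \<open>D > 0\<close> \<open>m \<le> 1\<close> by (simp add: \<eta>_def)
    let ?x = "\<alpha> *\<^sub>R d + \<beta> *\<^sub>R c + \<eta> *\<^sub>R n"
    have xd: "?x \<bullet> d = \<delta> / 2"
      using eq(1) n by (simp add: inner_add_left inner_commute[of c d] flip: \<delta>_def t_def)
    have xc: "?x \<bullet> c = - 1 / 2"
      using eq(2) n by (simp add: inner_add_left \<delta>_def t_def cc)
    have xn: "?x \<bullet> n = \<eta> * D"
      using n by (simp add: inner_add_left inner_commute[of d n] inner_commute[of c n])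
    have "?x \<bullet> ?x = \<alpha> * (?x \<bullet> d) + \<beta> * (?x \<bullet> c) + \<eta> * (?x \<bullet> n)"
      by (simp only: inner_add_right inner_scaleR_right)
    also have "\<dots> = 1"
      unfolding xd xc xn using \<eta> by (simp add: m_def)
    finally show ?thesis using that xd xc unfolding \<delta>_def by (metis norm_eq_1)
  qed
qed

text \<open>With \<open>p = a \<bullet> b\<close> and \<open>S\<close> the sum of the three inner products, this is the condition of
  the previous lemma for \<open>d = a + b\<close>.\<close>

definition pair_defect :: "real \<Rightarrow> real \<Rightarrow> real" where
  "pair_defect S p = p\<^sup>2 - (S + 1 / 2) * p + S\<^sup>2 + S - 1 / 2"

text \<open>For a unit vector \<open>x\<close> and \<open>d = a + b\<close>, the vector
  \<open>d - x\<close> is unit iff \<open>x \<bullet> d\<close> is half of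
  \<open>d \<bullet> d\<close>, and \<open>c + x\<close> is unit iff
  \<open>x \<bullet> c = - 1 / 2\<close>. So \<open>x\<close> and \<open>d - x\<close> serve as the
  new pair.\<close>

lemma exists_mergeable_pair:
  fixes a b c :: point
  assumes unit: "norm a = 1" "norm b = 1" "norm c = 1"
    and "pair_defect (a \<bullet> b + a \<bullet> c + b \<bullet> c) (a \<bullet> b) \<le> 0"
  obtains a' b' where "norm a' = 1" "norm b' = 1" "a' + b' = a + b" "norm (c + a') = 1"
proof -
  let ?d = "a + b"
  have sq: "a \<bullet> a = 1" "b \<bullet> b = 1" "c \<bullet> c = 1" using unit by (simp_all add: norm_eq_1)
  have dd: "?d \<bullet> ?d = 2 + 2 * (a \<bullet> b)" by (simp add: inner_add sq inner_commute)
  have dc: "?d \<bullet> c = a \<bullet> c + b \<bullet> c" by (simp add: inner_add_left)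
  have "4 * (?d \<bullet> c)\<^sup>2 + 2 * (?d \<bullet> ?d) * (?d \<bullet> c) \<le> (?d \<bullet> ?d) * (3 - ?d \<bullet> ?d)"
    using assms(4) unfolding dd dc pair_defect_def
    by (simp add: power2_eq_square algebra_simps)
  then obtain x where x: "norm x = 1" "x \<bullet> ?d = (?d \<bullet> ?d) / 2" "x \<bullet> c = - 1 / 2"
    using exists_unit_with_inner[OF unit(3)] by metis
  have xx: "x \<bullet> x = 1" using x by (simp add: norm_eq_1)
  have "(?d - x) \<bullet> (?d - x) = ?d \<bullet> ?d - 2 * (x \<bullet> ?d) + x \<bullet> x"
    by (simp add: inner_diff inner_commute)
  then have "norm (?d - x) = 1" using x xx by (simp add: norm_eq_1)
  moreover have "(c + x) \<bullet> (c + x) = c \<bullet> c + 2 * (x \<bullet> c) + x \<bullet> x"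
    by (simp add: inner_add inner_commute)
  then have "norm (c + x) = 1" using x xx sq by (simp add: norm_eq_1)
  ultimately show ?thesis using that x(1) by (metis add.commute diff_add_cancel)
qed

text \<open>Here \<open>t\<close> stands for \<open>a \<bullet> b + a \<bullet> c\<close>. The
  bounds on \<open>S - t\<close> say that \<open>b \<bullet> c\<close> lies between -1 and 1, and
  the last hypothesis is Cauchy-Schwarz for \<open>a\<close> and \<open>a + b + c\<close>.\<close>

lemma pair_defect_mean_nonpos:
  fixes S t :: real
  assumes "- 3 / 2 \<le> S" "S \<le> 0" "S - 1 \<le> t" "t \<le> S + 1" "(t + 1)\<^sup>2 \<le> 3 + 2 * S"
  shows "pair_defect S (t / 2) \<le> 0"
proof -
  \<comment> \<open>In terms of the vector sum \<open>s = a + b + c\<close>, \<open>e\<close> is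
    half of \<open>s \<bullet> s\<close> and \<sigma> is \<open>a \<bullet> s\<close>.\<close>
  define e \<sigma> where "e = S + 3 / 2" and "\<sigma> = t + 1"
  have S: "S = e - 3 / 2" and t: "t = \<sigma> - 1" by (simp_all add: e_def \<sigma>_def)
  have H: "4 * pair_defect S (t / 2) = \<sigma>\<^sup>2 - 2 * e * \<sigma> - 6 * e + 4 * e\<^sup>2"
    unfolding S t pair_defect_def by (simp add: power2_eq_square field_simps)
  have e: "0 \<le> e" "e \<le> 3 / 2" "e - 3 / 2 \<le> \<sigma>" "\<sigma> \<le> e + 1 / 2" "\<sigma>\<^sup>2 \<le> 2 * e"
    using assms by (simp_all add: S t)
  have "\<sigma>\<^sup>2 - 2 * e * \<sigma> - 6 * e + 4 * e\<^sup>2 \<le> 0"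
  proof (cases "e \<le> 1 / 2")
    \<comment> \<open>For small \<open>e\<close> Cauchy-Schwarz suffices: replacing the square of
      \<sigma> by \<open>2 * e\<close> leaves \<open>e\<close> times a nonpositive factor.\<close>
    case True
    then have "\<sigma>\<^sup>2 \<le> 1\<^sup>2" using e by simp
    then have "- 1 \<le> \<sigma>" using abs_le_square_iff[of \<sigma> 1] by simp
    then have "e * (- 2 * \<sigma> - 4 + 4 * e) \<le> 0"
      using e True by (intro mult_nonneg_nonpos) auto
    then show ?thesis using e by (simp add: algebra_simps power2_eq_square)
  next
    case False
    \<comment> \<open>Here the range of \<open>b \<bullet> c\<close> is used instead. By
      \<open>e - 3 / 2 \<le> \<sigma>\<close>, the target is at most this product plus three times
      the next one.\<close>
    have "(\<sigma> - (e - 3 / 2)) * (\<sigma> - (e + 1 / 2)) \<le> 0"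
      using e by (intro mult_nonneg_nonpos) auto
    moreover have "(e - 1 / 2) * (e - 3 / 2) \<le> 0"
      using e False by (intro mult_nonneg_nonpos) auto
    moreover have "(\<sigma> - (e - 3 / 2)) * (\<sigma> - (e + 1 / 2)) = \<sigma>\<^sup>2 - 2 * e * \<sigma> + \<sigma> + e\<^sup>2 - e - 3 / 4"
      "(e - 1 / 2) * (e - 3 / 2) = e\<^sup>2 - 2 * e + 3 / 4"
      by (simp_all add: field_simps power2_eq_square)
    ultimately show ?thesis using e(3) by linarith
  qed
  with H show ?thesis by simp
qed

text \<open>The mean need not be an inner product of one of the pairs; it only serves as an end
  point for the convexity argument below.\<close>

lemma pair_defect_mean_inner_nonpos:
  fixes a b c :: "'a::real_inner"
  assumes unit: "norm a = 1" "norm b = 1" "norm c = 1" and "a \<bullet> b + a \<bullet> c + b \<bullet> c \<le> 0"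
  shows "pair_defect (a \<bullet> b + a \<bullet> c + b \<bullet> c) ((a \<bullet> b + a \<bullet> c) / 2) \<le> 0"
proof -
  define S t where "S = a \<bullet> b + a \<bullet> c + b \<bullet> c" and "t = a \<bullet> b + a \<bullet> c"
  have sq: "a \<bullet> a = 1" "b \<bullet> b = 1" "c \<bullet> c = 1" using unit by (simp_all add: norm_eq_1)
  have n: "(a + b + c) \<bullet> (a + b + c) = 3 + 2 * S"
    by (simp add: inner_add sq inner_commute S_def)
  have a: "a \<bullet> (a + b + c) = t + 1" by (simp add: inner_add sq t_def)
  have "\<bar>b \<bullet> c\<bar> \<le> 1" using Cauchy_Schwarz_ineq2[of b c] unit by simp
  moreover have "(t + 1)\<^sup>2 \<le> 3 + 2 * S"
    using Cauchy_Schwarz_ineq[of a "a + b + c"] unfolding a n sq by simp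
  moreover have "0 \<le> 3 + 2 * S" using inner_ge_zero[of "a + b + c"] n by simp
  ultimately have "pair_defect S (t / 2) \<le> 0"
    using assms(4) by (intro pair_defect_mean_nonpos) (auto simp: S_def t_def)
  then show ?thesis by (simp add: S_def t_def)
qed

text \<open>The defect is convex in \<open>p\<close>, and the middle one of three numbers lies between its means with
  the other two.\<close>

lemma pair_defect_middle_nonpos:
  assumes "pair_defect S ((p + q) / 2) \<le> 0" "pair_defect S ((p + r) / 2) \<le> 0"
    "pair_defect S ((q + r) / 2) \<le> 0"
  shows "pair_defect S p \<le> 0 \<or> pair_defect S q \<le> 0 \<or> pair_defect S r \<le> 0"
proof -
  have convex: "pair_defect S z \<le> 0"
    if "pair_defect S x \<le> 0" "pair_defect S y \<le> 0" "x \<le> z" "z \<le> y" for x y z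
  proof (cases "x = y")
    case False
    \<comment> \<open>Interpolation of a monic quadratic: the cubic product is the exact gap between
      chord and graph, scaled by \<open>y - x\<close>.\<close>
    have "(y - x) * pair_defect S z + (y - x) * (y - z) * (z - x) =
        (y - z) * pair_defect S x + (z - x) * pair_defect S y"
      by (simp add: pair_defect_def field_simps power2_eq_square)
    moreover have "(y - z) * pair_defect S x \<le> 0" "(z - x) * pair_defect S y \<le> 0"
      "0 \<le> (y - x) * (y - z) * (z - x)"
      using that by (auto intro: mult_nonneg_nonpos)
    ultimately have "(y - x) * pair_defect S z \<le> 0" by linarith
    then show ?thesis using False that by (simp add: mult_le_0_iff)
  qed (use that in auto)
  have middle: "pair_defect S y \<le> 0"
    if "pair_defect S ((x + y) / 2) \<le> 0" "pair_defect S ((y + z) / 2) \<le> 0" "x \<le> y" "y \<le> z"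
    for x y z
    using that(1,2) by (rule convex) (use that(3,4) in simp_all)
  have sym: "pair_defect S ((q + p) / 2) \<le> 0" "pair_defect S ((r + p) / 2) \<le> 0"
    "pair_defect S ((r + q) / 2) \<le> 0"
    using assms by (simp_all only: add.commute)
  \<comment> \<open>One instance for each of the six orderings of \<open>p\<close>,
    \<open>q\<close>, \<open>r\<close>.\<close>
  note mid = middle[OF assms(1,3)] middle[OF assms(2) sym(3)] middle[OF sym(1) assms(2)]
    middle[OF assms(3) sym(2)] middle[OF sym(2) assms(1)] middle[OF sym(3,1)]
  show ?thesis
  proof (cases "p \<le> q")
    case True
    then show ?thesis using mid(1,2,5) by (meson linear)
  next
    case False
    then show ?thesis using mid(3,4,6) by (meson linear)
  qed
qed

subsection \<open>Shortening a closed walk\<close>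

lemma filling_reduce:
  assumes "sum_list us = 0" "\<forall>u\<in>set us. norm u = 1" "length us = Suc n" "n \<ge> 3"
  obtains q vs where "sum_list vs = 0" "\<forall>v\<in>set vs. norm v = 1" "length vs = n"
    "filling (2 * n - 2) (walk p us - walk q vs)"
proof -
  obtain u v w M where M: "mset us = {#u, v, w#} + M" and S: "u \<bullet> v + u \<bullet> w + v \<bullet> w \<le> 0"
    using exists_obtuse_triple[OF assms(1,2)] assms(3,4) by (metis le_SucI)
  have "set_mset (mset us) = set us" by simp
  then have unit: "norm u = 1" "norm v = 1" "norm w = 1" "\<forall>x\<in>#M. norm x = 1"
    using assms(2) M by auto
  let ?S = "u \<bullet> v + u \<bullet> w + v \<bullet> w"
  have "pair_defect ?S ((u \<bullet> v + u \<bullet> w) / 2) \<le> 0"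
    using pair_defect_mean_inner_nonpos[of u v w] unit S by simp
  moreover have "pair_defect ?S ((u \<bullet> v + v \<bullet> w) / 2) \<le> 0"
    using pair_defect_mean_inner_nonpos[of v u w] unit S by (simp add: inner_commute algebra_simps)
  moreover have "pair_defect ?S ((u \<bullet> w + v \<bullet> w) / 2) \<le> 0"
    using pair_defect_mean_inner_nonpos[of w u v] unit S by (simp add: inner_commute algebra_simps)
  ultimately have "pair_defect ?S (u \<bullet> v) \<le> 0 \<or> pair_defect ?S (u \<bullet> w) \<le> 0 \<or>
      pair_defect ?S (v \<bullet> w) \<le> 0"
    by (rule pair_defect_middle_nonpos)
  \<comment> \<open>The sum \<open>?S\<close> is symmetric in the three vectors, so the pair with
    nonpositive defect may be named \<open>a\<close>, \<open>b\<close> and the third vector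
    \<open>c\<close>.\<close>
  then obtain a b c where abc: "mset us = add_mset c (add_mset a (add_mset b M))"
    "norm a = 1" "norm b = 1" "norm c = 1"
    "pair_defect (a \<bullet> b + a \<bullet> c + b \<bullet> c) (a \<bullet> b) \<le> 0"
  proof (elim disjE)
    assume "pair_defect ?S (u \<bullet> v) \<le> 0"
    with that[of w u v] show ?thesis using M unit by (simp add: add_mset_commute)
  next
    assume "pair_defect ?S (u \<bullet> w) \<le> 0"
    with that[of v u w] show ?thesis using M unit
      by (simp add: add_mset_commute inner_commute algebra_simps)
  next
    assume "pair_defect ?S (v \<bullet> w) \<le> 0"
    with that[of u v w] show ?thesis using M unit
      by (simp add: add_mset_commute inner_commute algebra_simps)
  qed
  obtain a' b' where ab: "norm a' = 1" "norm b' = 1" "a' + b' = a + b" "norm (c + a') = 1"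
    using exists_mergeable_pair[OF abc(2-)] by metis
  obtain q rest where rest: "mset rest = M"
    "filling (2 * size M + 1) (walk p us - walk q (c # a # b # rest))"
    using filling_triple_to_front[OF abc(1) assms(2,1)] by metis
  have set_rest: "set rest = set_mset M" using rest(1) by auto
  have "filling 1 (walk q (c # a # b # rest) - walk q (c # a' # b' # rest))"
    using filling_replace_pair[of a b a' b' q "[c]" rest] abc ab by simp
  from filling_diff_trans[OF rest(2) this]
  have "filling (2 * size M + 2) (walk p us - walk q (c # a' # b' # rest))"
    by (simp only: add.assoc one_add_one)
  moreover have "filling 0 (walk q (c # a' # b' # rest) - walk q ((c + a') # b' # rest))"
    using abc ab by (intro filling_merge) auto
  ultimately have "filling (2 * size M + 2) (walk p us - walk q ((c + a') # b' # rest))"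
    using filling_diff_trans by fastforce
  \<comment> \<open>Thus \<open>2 * size M + 2\<close> is \<open>2 * n - 2\<close>: the moves cost
    \<open>2 * size M + 1\<close>, the rotation of the pair 1, and the merge nothing.\<close>
  moreover have size: "n = size M + 2"
    using arg_cong[OF M, of size] assms(3) by simp
  moreover have "sum_list ((c + a') # b' # rest) = 0"
  proof -
    have "sum_list us = c + (a + (b + sum_list rest))"
      using abc(1) rest(1) by (metis sum_mset.add_mset sum_mset_sum_list)
    then show ?thesis using assms(1) ab(3) by (simp add: add.assoc) (metis add.assoc)
  qed
  moreover have "length ((c + a') # b' # rest) = n"
    using size rest(1) by auto
  ultimately show ?thesis
    using that[of "(c + a') # b' # rest" q] ab unit(4) set_rest by auto
qed

text \<open>Three steps already form a unit triangle. The bound is the sum of the costs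
  \<open>2 * m - 2\<close> of \<open>filling_reduce\<close> for \<open>m\<close> from 3 to
  \<open>n - 1\<close>.\<close>

lemma filling_closed_walk:
  assumes "n \<ge> 3" "sum_list us = 0" "\<forall>u\<in>set us. norm u = 1" "length us = n"
  shows "filling (n * (n - 3)) (walk p us)"
  using assms
proof (induction n arbitrary: us p rule: dec_induct)
  case base
  then obtain u v w where us: "us = [u, v, w]"
    by (auto simp: eval_nat_numeral length_Suc_conv)
  have unit: "norm u = 1" "norm v = 1" "norm w = 1" and "u + v + w = 0"
    using base us by (simp_all add: add.assoc)
  then have w: "p + u + v + w = p" "p + u + v - p = - w"
    by (simp_all add: add.assoc eq_neg_iff_add_eq_0)
  have "dist p (p + u) = 1" "dist (p + u) (p + u + v) = 1"
    using unit by (simp_all add: dist_norm)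
  moreover have "dist (p + u + v) p = 1"
    unfolding dist_norm w(2) using unit(3) by simp
  ultimately have "unit_triangle [p, p + u, p + u + v]"
    unfolding unit_triangle_def by blast
  moreover have "boundary [p, p + u, p + u + v] = walk p us"
    unfolding us walk.simps w(1) boundary_triangle by (simp add: add.assoc)
  ultimately have "filling 0 (walk p us)"
    using filling_triangle by metis
  then show ?case by simp
next
  case (step n)
  obtain q vs where vs: "sum_list vs = 0" "\<forall>v\<in>set vs. norm v = 1" "length vs = n"
    "filling (2 * n - 2) (walk p us - walk q vs)"
    using filling_reduce[OF step.prems(1,2,3) step.hyps(1)] by metis
  have "filling (2 * n - 2 + n * (n - 3)) (walk p us)"
    using filling_add[OF vs(4) step.IH[OF vs(1-3), of q]] by simp
  moreover have "2 * n - 2 + n * (n - 3) = Suc n * (Suc n - 3)"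
  proof -
    obtain m where "n = m + 3" using step.hyps by (metis add.commute le_Suc_ex)
    then show ?thesis by (simp add: algebra_simps)
  qed
  ultimately show ?case by simp
qed

section \<open>Integral curves as closed walks, and the final count\<close>

lemma boundary_eq_walk:
  assumes "integral_curve \<gamma>"
  obtains us where "length us = length \<gamma>" "sum_list us = 0" "\<forall>u\<in>set us. norm u = 1"
    "boundary \<gamma> = walk (hd \<gamma>) us"
proof -
  define n where "n = length \<gamma>"
  define us where "us = map (\<lambda>j. \<gamma> ! (Suc j mod n) - \<gamma> ! j) [0..<n]"
  have "n > 0" using assms by (simp add: n_def integral_curve_def)
  then have hd: "hd \<gamma> = \<gamma> ! 0" by (simp add: n_def hd_conv_nth)
  \<comment> \<open>The case \<open>j = n\<close> is included: there the index wraps around to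
    vertex 0, which makes the steps sum to zero.\<close>
  have partial: "hd \<gamma> + sum_list (take j us) = \<gamma> ! (j mod n)" if "j \<le> n" for j
    using that
  proof (induction j)
    case 0
    then show ?case by (simp add: hd)
  next
    case (Suc j)
    then have "take (Suc j) us = take j us @ [\<gamma> ! (Suc j mod n) - \<gamma> ! j]"
      by (simp add: us_def take_Suc_conv_app_nth)
    then show ?case using Suc by (simp add: algebra_simps)
  qed
  show ?thesis
  proof
    show "length us = length \<gamma>" by (simp add: us_def n_def)
    then show "sum_list us = 0" using partial[of n] by (simp add: hd n_def)
    show "\<forall>u\<in>set us. norm u = 1"
      using assms by (auto simp: us_def n_def integral_curve_def edge_start_def edge_end_def
          dist_norm norm_minus_commute)
    have "walk (hd \<gamma>) us = (\<Sum>j<n. edge_chain (\<gamma> ! (j mod n)) (\<gamma> ! (Suc j mod n)))"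
      unfolding walk_conv_sum using partial \<open>length us = length \<gamma>\<close>
      by (intro sum.cong) (auto simp: n_def)
    then show "boundary \<gamma> = walk (hd \<gamma>) us"
      by (simp add: boundary_def edge_start_def edge_end_def n_def)
  qed
qed

lemma filling_integral_curve:
  assumes "integral_curve \<gamma>"
  shows "filling (length \<gamma> * (length \<gamma> - 3)) (boundary \<gamma>)"
proof -
  obtain us where us: "length us = length \<gamma>" "sum_list us = 0" "\<forall>u\<in>set us. norm u = 1"
    "boundary \<gamma> = walk (hd \<gamma>) us"
    using boundary_eq_walk[OF assms] by metis
  \<comment> \<open>Below three edges truncated subtraction makes the bound 0: a single unit step
    cannot close up, and two steps retrace one edge.\<close>
  consider "length \<gamma> = 0" | "length \<gamma> = 1" | "length \<gamma> = 2" | "length \<gamma> \<ge> 3" by linarith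
  then show ?thesis
  proof cases
    case 1
    then show ?thesis using us by (simp add: filling_zero)
  next
    case 2
    then obtain u where "us = [u]" using us(1) by (auto simp: length_Suc_conv)
    then show ?thesis using us by auto
  next
    case 3
    then obtain u v where uv: "us = [u, v]"
      using us(1) by (auto simp: eval_nat_numeral length_Suc_conv)
    then have "v = - u" using us(2) by (simp add: eq_neg_iff_add_eq_0 add.commute)
    then have "boundary \<gamma> = 0"
      using us(4) uv edge_chain_flip[of "hd \<gamma> + u" "hd \<gamma>"] by simp
    then show ?thesis using 3 by (simp add: filling_zero)
  next
    case 4
    then show ?thesis using filling_closed_walk us by metis
  qed
qed

theorem theorem1p3:
  fixes \<gamma> :: "point list"
  assumes "integral_curve \<gamma>"
  shows "(\<exists>\<rho>s. set \<rho>s \<subseteq> unit_rhombi \<and> orientably_cobordant [\<gamma>] \<rho>s) \<and>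
    (\<forall>n\<ge>3. \<gamma> \<in> integral_curves n \<longrightarrow>
      (\<exists>\<rho>s. int (length \<rho>s) = int n ^ 2 + 2 * int n - 12 \<and>
        set \<rho>s \<subseteq> unit_rhombi \<and> orientably_cobordant [\<gamma>] \<rho>s))"
proof (intro conjI allI impI)
  note fill = filling_integral_curve[OF assms]
  show "\<exists>\<rho>s. set \<rho>s \<subseteq> unit_rhombi \<and> orientably_cobordant [\<gamma>] \<rho>s"
    using orientably_cobordant_of_filling[OF assms fill] by blast
  fix n :: nat
  assume "3 \<le> n" "\<gamma> \<in> integral_curves n"
  then have n: "length \<gamma> = n" using curve_length_eq[OF assms] by (simp add: integral_curves_def)
  \<comment> \<open>In terms of \<open>m\<close>, the bound \<open>n * (n - 3)\<close> is
    \<open>m\<^sup>2 + 3 * m\<close> and the required number is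
    \<open>m\<^sup>2 + 8 * m + 3\<close>, so padding suffices and no subtraction of naturals
    remains.\<close>
  obtain m where m: "n = m + 3" using \<open>3 \<le> n\<close> by (metis add.commute le_Suc_ex)
  have "n * (n - 3) \<le> m\<^sup>2 + 8 * m + 3" by (simp add: m algebra_simps power2_eq_square)
  then have "filling (m\<^sup>2 + 8 * m + 3) (boundary \<gamma>)"
    using filling_mono fill n by blast
  from orientably_cobordant_of_filling[OF assms this]
  obtain \<rho>s where "length \<rho>s = m\<^sup>2 + 8 * m + 3" "set \<rho>s \<subseteq> unit_rhombi"
    "orientably_cobordant [\<gamma>] \<rho>s"
    by blast
  then show "\<exists>\<rho>s. int (length \<rho>s) = int n ^ 2 + 2 * int n - 12 \<and>
      set \<rho>s \<subseteq> unit_rhombi \<and> orientably_cobordant [\<gamma>] \<rho>s"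
    by (intro exI[of _ \<rho>s]) (simp add: m algebra_simps power2_eq_square)
qed

end
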